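(* Let $k\ge 2$, $f\in P_k^n$, let $M\subseteq Ess(f)$ be a non-empty set of essential variables of $f$ which is inseparable in $f$, and let $\beta\in Sys(Dis(M,f))$. Then: (i) $M\cup\beta\in Sep(f)$; (ii) for every proper subset $\alpha\subsetneq\beta$, $M\cup\alpha\notin Sep(f)$.
   Context: $Z_k=\{0,1,\dots,k-1\}$ is the ring of integers modulo $k$, and $P_k^n$ is the set of all functions $f:Z_k^n\to Z_k$ in the variables $x_1,\dots,x_n$. A variable $x_i$ is essential in $f$ if there are $a_1,\dots,a_n,b\in Z_k$ with $f(a_1,\dots,a_{i-1},a_i,a_{i+1},\dots,a_n)\neq f(a_1,\dots,a_{i-1},b,a_{i+1},\dots,a_n)$; $Ess(f)$ is the set of essential variables of $f$. For $x_i\in Ess(f)$ and $c\in Z_k$, $f(x_i=c)$ denotes the function obtained from $f$ by replacing $x_i$ by the constant $c$ (a simple subfunction of $f$), written $f(x_i=c)\prec f$; $\preceq$ is the reflexive–transitive closure of $\prec$, and $g$ is a subfunction of $f$ if $g\preceq f$. A non-empty set $M\subseteq Ess(f)$ is separable in $f$ if $M=Ess(g)$ for some subfunction $g\preceq f$; $Sep(f)$ is the set of separable sets of $f$, and a set of essential variables that is not separable is called inseparable. For non-empty disjoint $M,J\subseteq Ess(f)$, $J$ is a distributive set of $M$ in $f$ if for every tuple $\mathbf c\in Z_k^{|J|}$, the function $g$ obtained from $f$ by replacing the variables of $J$ by the constants $\mathbf c$ satisfies $M\not\subseteq Ess(g)$, and $J$ is minimal with respect to $\subseteq$ with this property; $Dis(M,f)$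 is the set of all distributive sets of $M$ in $f$. For a finite family $\mathcal F$ of non-empty sets, a set $\beta$ is an $s$-system of $\mathcal F$ if every $P\in\mathcal F$ contains some element of $\beta$, and for every $x\in\beta$ there is $P\in\mathcal F$ with $P\cap\beta=\{x\}$; $Sys(\mathcal F)$ is the set of all $s$-systems of $\mathcal F$. *)

theory Defs
  imports Main "HOL-Library.FuncSet"
begin

text \<open>
  The variable \<open>x\<^sub>i\<close> is represented by its index \<open>i \<in> {1..n}\<close>, so sets of variables are sets of
  indices. Only the underlying set \<open>{0, \<dots>, k - 1}\<close> of the ring of integers modulo \<open>k\<close> is used.
\<close>

definition Zk :: "nat \<Rightarrow> nat set" where
  "Zk k = {..<k}"

definition tuples :: "nat \<Rightarrow> nat \<Rightarrow> (nat \<Rightarrow> nat) set" where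
  "tuples k n = {1..n} \<rightarrow>\<^sub>E Zk k"

definition Pkn :: "nat \<Rightarrow> nat \<Rightarrow> ((nat \<Rightarrow> nat) \<Rightarrow> nat) set" where
  "Pkn k n = tuples k n \<rightarrow>\<^sub>E Zk k"

definition Ess :: "nat \<Rightarrow> nat \<Rightarrow> ((nat \<Rightarrow> nat) \<Rightarrow> nat) \<Rightarrow> nat set" where
  "Ess k n f = {i \<in> {1..n}. \<exists>a \<in> tuples k n. \<exists>b \<in> Zk k. f a \<noteq> f (a(i := b))}"

text \<open>
  Replacing variables by constants keeps the arity: the result is again an element of \<open>Pkn k n\<close>,
  in which the replaced variables are inessential.
\<close>

definition subst_const ::
    "nat \<Rightarrow> nat \<Rightarrow> ((nat \<Rightarrow> nat) \<Rightarrow> nat) \<Rightarrow> nat \<Rightarrow> nat \<Rightarrow> ((nat \<Rightarrow> nat) \<Rightarrow> nat)" where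
  "subst_const k n f i c = (\<lambda>a \<in> tuples k n. f (a(i := c)))"

definition subst_consts ::
    "nat \<Rightarrow> nat \<Rightarrow> ((nat \<Rightarrow> nat) \<Rightarrow> nat) \<Rightarrow> nat set \<Rightarrow> (nat \<Rightarrow> nat) \<Rightarrow> ((nat \<Rightarrow> nat) \<Rightarrow> nat)" where
  "subst_consts k n f J c = (\<lambda>a \<in> tuples k n. f (override_on a c J))"

definition simple_subfunction ::
    "nat \<Rightarrow> nat \<Rightarrow> ((nat \<Rightarrow> nat) \<Rightarrow> nat) \<Rightarrow> ((nat \<Rightarrow> nat) \<Rightarrow> nat) \<Rightarrow> bool" where
  "simple_subfunction k n g f \<longleftrightarrow> (\<exists>i \<in> Ess k n f. \<exists>c \<in> Zk k. g = subst_const k n f i c)"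

definition subfunction ::
    "nat \<Rightarrow> nat \<Rightarrow> ((nat \<Rightarrow> nat) \<Rightarrow> nat) \<Rightarrow> ((nat \<Rightarrow> nat) \<Rightarrow> nat) \<Rightarrow> bool" where
  "subfunction k n = (simple_subfunction k n)\<^sup>*\<^sup>*"

definition Sep :: "nat \<Rightarrow> nat \<Rightarrow> ((nat \<Rightarrow> nat) \<Rightarrow> nat) \<Rightarrow> nat set set" where
  "Sep k n f = {M. M \<noteq> {} \<and> M \<subseteq> Ess k n f \<and> (\<exists>g. subfunction k n g f \<and> M = Ess k n g)}"

definition inseparable :: "nat \<Rightarrow> nat \<Rightarrow> nat set \<Rightarrow> ((nat \<Rightarrow> nat) \<Rightarrow> nat) \<Rightarrow> bool" where
  "inseparable k n M f \<longleftrightarrow> M \<subseteq> Ess k n f \<and> M \<notin> Sep k n f"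

text \<open>
  \<open>distributes k n J M f\<close> is the defining property of a distributive set without minimality; a tuple
  of constants for the variables in \<open>J\<close> is a function on \<open>J\<close>.
\<close>

definition distributes ::
    "nat \<Rightarrow> nat \<Rightarrow> nat set \<Rightarrow> nat set \<Rightarrow> ((nat \<Rightarrow> nat) \<Rightarrow> nat) \<Rightarrow> bool" where
  "distributes k n J M f \<longleftrightarrow>
     M \<noteq> {} \<and> J \<noteq> {} \<and> M \<subseteq> Ess k n f \<and> J \<subseteq> Ess k n f \<and> M \<inter> J = {} \<and>
     (\<forall>c \<in> J \<rightarrow>\<^sub>E Zk k. \<not> M \<subseteq> Ess k n (subst_consts k n f J c))"

definition Dis :: "nat \<Rightarrow> nat \<Rightarrow> nat set \<Rightarrow> ((nat \<Rightarrow> nat) \<Rightarrow> nat) \<Rightarrow> nat set set" where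
  "Dis k n M f = {J. distributes k n J M f \<and> (\<forall>J'. J' \<subset> J \<longrightarrow> \<not> distributes k n J' M f)}"

definition Sys :: "'a set set \<Rightarrow> 'a set set" where
  "Sys F = {\<beta>. (\<forall>Q \<in> F. Q \<inter> \<beta> \<noteq> {}) \<and> (\<forall>x \<in> \<beta>. \<exists>Q \<in> F. Q \<inter> \<beta> = {x})}"

end

theory Submission
  imports Defs
begin

text \<open>
  Substituting constants only shrinks the set of essential variables, and substituting for
  inessential variables changes nothing. Hence, if some substitution for \<open>J\<close> keeps all variables of
  \<open>M\<close> essential, then so does its restriction to any subset of \<open>J\<close>.

  For (i), the set of essential variables outside \<open>M \<union> \<beta>\<close> contains no distributive set, as \<beta> meets
  all of those; so some substitution for it keeps \<open>M\<close> essential. If \<open>x \<in> \<beta>\<close> became inessential,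
  one could also substitute for \<open>x\<close> and so for the whole of a distributive set meeting \<open>\<beta>\<close> only in \<open>x\<close>.
  For (ii), if \<open>M \<union> \<alpha> = Ess(g)\<close> and \<open>x \<in> \<beta> - \<alpha>\<close>, then no variable of a distributive set \<open>Q\<close> with
  \<open>Q \<inter> \<beta> = {x}\<close> is essential in \<open>g\<close>, so one may assume that \<open>g\<close> arises by substituting at least for \<open>Q\<close>.
\<close>

section \<open>Essential variables under substitution of constants\<close>

lemma tuples_upd:
  assumes "a \<in> tuples k n" "i \<in> {1..n}" "c \<in> Zk k"
  shows "a(i := c) \<in> tuples k n"
  using assms by (auto simp: tuples_def PiE_iff extensional_def)

lemma tuples_override_on:
  assumes "a \<in> tuples k n" "J \<subseteq> {1..n}" "c \<in> J \<rightarrow> Zk k"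
  shows "override_on a c J \<in> tuples k n"
  using assms by (auto simp: tuples_def PiE_iff extensional_def override_on_def)

lemma Ess_subset: "Ess k n f \<subseteq> {1..n}"
  by (auto simp: Ess_def)

lemma not_in_EssD:
  assumes "i \<notin> Ess k n f" "i \<in> {1..n}" "a \<in> tuples k n" "b \<in> Zk k"
  shows "f (a(i := b)) = f a"
  using assms by (force simp: Ess_def)

lemma subst_const_inessential:
  assumes "f \<in> extensional (tuples k n)" "i \<notin> Ess k n f" "i \<in> {1..n}" "c \<in> Zk k"
  shows "subst_const k n f i c = f"
  using assms by (auto simp: subst_const_def extensional_def fun_eq_iff not_in_EssD)

lemma subst_consts_extensional: "subst_consts k n f J c \<in> extensional (tuples k n)"
  by (simp add: subst_consts_def)

lemma subst_consts_cong:
  assumes "\<And>j. j \<in> J \<Longrightarrow> c j = d j"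
  shows "subst_consts k n f J c = subst_consts k n f J d"
proof -
  have "override_on a c J = override_on a d J" for a
    using assms by (auto simp: override_on_def)
  then show ?thesis
    by (simp add: subst_consts_def)
qed

lemma subst_consts_empty:
  assumes "f \<in> extensional (tuples k n)"
  shows "subst_consts k n f {} c = f"
  using assms by (simp add: subst_consts_def extensional_restrict)

lemma subst_consts_insert:
  assumes "i \<in> {1..n}" "c i \<in> Zk k"
  shows "subst_consts k n f (insert i J) c = subst_const k n (subst_consts k n f J c) i (c i)"
proof
  fix a
  have "override_on (a(i := c i)) c J = override_on a c (insert i J)"
    by (auto simp: override_on_def)
  then show "subst_consts k n f (insert i J) c a
      = subst_const k n (subst_consts k n f J c) i (c i) a"
    using assms by (simp add: subst_consts_def subst_const_def restrict_def tuples_upd)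
qed

text \<open>Both stages take their constants from the same \<open>c\<close>, so they agree on the
  overlap of \<open>J\<close> and \<open>L\<close>, which may be non-empty.\<close>

lemma subst_consts_Un:
  assumes "L \<subseteq> {1..n}" "c \<in> L \<rightarrow> Zk k"
  shows "subst_consts k n f (J \<union> L) c = subst_consts k n (subst_consts k n f J c) L c"
proof
  fix a
  have "override_on (override_on a c L) c J = override_on a c (J \<union> L)"
    by (auto simp: override_on_def)
  then show "subst_consts k n f (J \<union> L) c a = subst_consts k n (subst_consts k n f J c) L c a"
    using assms by (simp add: subst_consts_def restrict_def tuples_override_on)
qed

lemma subst_consts_inessential:
  assumes "f \<in> extensional (tuples k n)" "J \<subseteq> {1..n}" "c \<in> J \<rightarrow> Zk k" "J \<inter> Ess k n f = {}"
  shows "subst_consts k n f J c = f"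
proof -
  have "finite J"
    using assms(2) finite_subset by blast
  then show ?thesis
    using assms(2-)
  proof induction
    case empty
    then show ?case
      using assms(1) by (simp add: subst_consts_empty)
  next
    case (insert i J)
    then show ?case
      using assms(1) by (simp add: subst_consts_insert subst_const_inessential)
  qed
qed

lemma Ess_subst_consts:
  assumes "J \<subseteq> {1..n}" "c \<in> J \<rightarrow> Zk k"
  shows "Ess k n (subst_consts k n f J c) \<subseteq> Ess k n f - J"
proof
  fix i
  assume "i \<in> Ess k n (subst_consts k n f J c)"
  then obtain a b where i: "i \<in> {1..n}" and a: "a \<in> tuples k n" and b: "b \<in> Zk k"
    and neq: "subst_consts k n f J c a \<noteq> subst_consts k n f J c (a(i := b))"
    by (auto simp: Ess_def)
  have neq': "f (override_on a c J) \<noteq> f (override_on (a(i := b)) c J)"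
    using neq a i b by (simp add: subst_consts_def tuples_upd)
  have "i \<notin> J"
  proof
    assume "i \<in> J"
    \<comment> \<open>The constant \<open>c i\<close> overwrites the change made at
      \<open>i\<close>.\<close>
    then have "override_on (a(i := b)) c J = override_on a c J"
      by (auto simp: override_on_def)
    with neq' show False
      by simp
  qed
  then have "override_on (a(i := b)) c J = (override_on a c J)(i := b)"
    by (auto simp: override_on_def)
  then have "i \<in> Ess k n f"
    using neq' i b tuples_override_on[OF a assms] unfolding Ess_def by force
  with \<open>i \<notin> J\<close> show "i \<in> Ess k n f - J"
    by simp
qed

text \<open>Substituting for \<open>L\<close> amounts to substituting for \<open>J\<close> first and
  then for all of \<open>L\<close>; the second stage creates no essential variables.\<close>

lemma Ess_subst_consts_antimono:
  assumes "J \<subseteq> L" "L \<subseteq> {1..n}" "c \<in> L \<rightarrow> Zk k"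
  shows "Ess k n (subst_consts k n f L c) \<subseteq> Ess k n (subst_consts k n f J c)"
proof -
  have "subst_consts k n f L c = subst_consts k n (subst_consts k n f J c) L c"
    using subst_consts_Un[of L n c k f J] assms by (simp add: Un_absorb1)
  then show ?thesis
    using Ess_subst_consts[OF assms(2,3)] by auto
qed

section \<open>Subfunctions as simultaneous substitutions\<close>

lemma subst_consts_subfunction:
  assumes "f \<in> extensional (tuples k n)" "J \<subseteq> {1..n}" "c \<in> J \<rightarrow> Zk k"
  shows "subfunction k n (subst_consts k n f J c) f"
proof -
  have "finite J"
    using assms(2) finite_subset by blast
  then show ?thesis
    using assms(2-)
  proof induction
    case empty
    then show ?case
      using assms(1) by (simp add: subst_consts_empty subfunction_def)
  next
    case (insert i J)
    define g where "g = subst_consts k n f J c"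
    have g: "subfunction k n g f"
      using insert by (auto simp: g_def)
    have i: "i \<in> {1..n}" "c i \<in> Zk k"
      using insert by auto
    have eq: "subst_consts k n f (insert i J) c = subst_const k n g i (c i)"
      unfolding g_def by (rule subst_consts_insert) (use i in auto)
    show ?case
    proof (cases "i \<in> Ess k n g")
      case True
      then have "simple_subfunction k n (subst_const k n g i (c i)) g"
        using i by (auto simp: simple_subfunction_def)
      then show ?thesis
        using g unfolding eq subfunction_def by (rule converse_rtranclp_into_rtranclp)
    next
      \<comment> \<open>\<open>simple_subfunction\<close> admits only essential variables, but for
        an inessential \<open>i\<close> the chain needs no further link.\<close>
      case False
      then have "subst_const k n g i (c i) = g"
        using i by (intro subst_const_inessential) (auto simp: g_def subst_consts_extensional)
      then show ?thesis
        using g eq by simp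
    qed
  qed
qed

text \<open>A chain of simple substitutions collapses into one: each variable replaced is still
  essential at that moment, hence not among those replaced before, so its constant joins
  \<open>c\<close> without conflict.\<close>

lemma subfunction_imp_subst_consts:
  assumes "f \<in> extensional (tuples k n)" "subfunction k n g f"
  shows "\<exists>K c. K \<subseteq> {1..n} \<and> c \<in> K \<rightarrow> Zk k \<and> g = subst_consts k n f K c"
  using assms(2) unfolding subfunction_def
proof (induction rule: converse_rtranclp_induct)
  case base
  then show ?case
    using subst_consts_empty[OF assms(1)] by (metis Pi_I empty_iff empty_subsetI)
next
  case (step y z)
  then obtain K c where K: "K \<subseteq> {1..n}" "c \<in> K \<rightarrow> Zk k" and z: "z = subst_consts k n f K c"
    by blast
  from step obtain i d where i: "i \<in> Ess k n z" and d: "d \<in> Zk k" and y: "y = subst_const k n z i d"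
    by (auto simp: simple_subfunction_def)
  have "i \<notin> K"
    using i Ess_subst_consts[OF K] z by auto
  moreover have i': "i \<in> {1..n}"
    using i Ess_subset by blast
  ultimately have "y = subst_consts k n f (insert i K) (c(i := d))"
    using d y z by (auto simp: subst_consts_insert intro!: arg_cong2[where f = "\<lambda>h. subst_const k n h i"]
        subst_consts_cong)
  moreover have "insert i K \<subseteq> {1..n}" "c(i := d) \<in> insert i K \<rightarrow> Zk k"
    using i' K d by auto
  ultimately show ?case
    by blast
qed

section \<open>Distributive sets\<close>

lemma distributes_imp_Dis:
  assumes "distributes k n J M f"
  obtains Q where "Q \<subseteq> J" "Q \<in> Dis k n M f"
proof -
  have "finite J"
    using assms Ess_subset[of k n f] unfolding distributes_def
    by (meson finite_atLeastAtMost finite_subset)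
  then have "\<exists>Q\<subseteq>J. Q \<in> Dis k n M f"
    using assms
  proof (induction rule: finite_psubset_induct)
    case (psubset J)
    show ?case
    proof (cases "\<exists>J'. J' \<subset> J \<and> distributes k n J' M f")
      case True
      then obtain J' where "J' \<subset> J" "distributes k n J' M f"
        by blast
      with psubset.IH obtain Q where "Q \<subseteq> J'" "Q \<in> Dis k n M f"
        by blast
      with \<open>J' \<subset> J\<close> show ?thesis
        by blast
    next
      case False
      with psubset.prems have "J \<in> Dis k n M f"
        by (simp add: Dis_def)
      then show ?thesis
        by blast
    qed
  qed
  then show ?thesis
    using that by blast
qed

lemma DisD:
  assumes "Q \<in> Dis k n M f"
  shows "Q \<subseteq> Ess k n f" "Q \<subseteq> {1..n}" "M \<inter> Q = {}"
  using assms Ess_subset[of k n f] by (auto simp: Dis_def distributes_def)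

text \<open>Fixing further variables cannot make a variable of \<open>M\<close> essential again, so
  the defining property of \<open>Q\<close> passes to every larger \<open>J\<close>.\<close>

lemma Dis_not_subset_Ess:
  assumes "Q \<in> Dis k n M f" "Q \<subseteq> J" "J \<subseteq> {1..n}" "c \<in> J \<rightarrow> Zk k"
  shows "\<not> M \<subseteq> Ess k n (subst_consts k n f J c)"
proof -
  have "restrict c Q \<in> Q \<rightarrow>\<^sub>E Zk k"
    using assms by auto
  then have "\<not> M \<subseteq> Ess k n (subst_consts k n f Q (restrict c Q))"
    using assms(1) unfolding Dis_def distributes_def by blast
  moreover have "subst_consts k n f Q (restrict c Q) = subst_consts k n f Q c"
    by (rule subst_consts_cong) simp
  ultimately show ?thesis
    using Ess_subst_consts_antimono[OF assms(2-4)] by auto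
qed

text \<open>The key to both claims: otherwise the variables of \<open>Q\<close> could be fixed as
  well without changing the subfunction, and \<open>M\<close> would survive a substitution covering
  \<open>Q\<close>.\<close>

lemma Dis_meets_Ess:
  assumes "0 < k" "Q \<in> Dis k n M f" "J \<subseteq> {1..n}" "c \<in> J \<rightarrow> Zk k"
    and "M \<subseteq> Ess k n (subst_consts k n f J c)"
  shows "Q \<inter> Ess k n (subst_consts k n f J c) \<noteq> {}"
proof
  assume disj: "Q \<inter> Ess k n (subst_consts k n f J c) = {}"
  \<comment> \<open>On \<open>J\<close> the given constants are kept; elsewhere any element of
    \<open>Zk k\<close> would do.\<close>
  define d where "d j = (if j \<in> J then c j else 0)" for j
  have Q: "Q \<subseteq> {1..n}"
    using assms(2) by (rule DisD)
  have d: "d j \<in> Zk k" for j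
    using assms(1,4) by (auto simp: d_def Zk_def)
  have eq: "subst_consts k n f J d = subst_consts k n f J c"
    by (rule subst_consts_cong) (simp add: d_def)
  have "subst_consts k n f (J \<union> Q) d = subst_consts k n (subst_consts k n f J c) Q d"
    using subst_consts_Un[OF Q, of d k f J] d eq by simp
  also have "\<dots> = subst_consts k n f J c"
    using disj Q d by (intro subst_consts_inessential subst_consts_extensional) auto
  finally have "M \<subseteq> Ess k n (subst_consts k n f (J \<union> Q) d)"
    using assms(5) by simp
  then show False
    using Dis_not_subset_Ess[OF assms(2), of "J \<union> Q" d] assms(3) Q d by auto
qed

section \<open>Extending \<open>M\<close> by an s-system\<close>

theorem theorem2p1:
  fixes k n :: nat and f :: "(nat \<Rightarrow> nat) \<Rightarrow> nat" and M \<beta> :: "nat set"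
  assumes "k \<ge> 2"
    and "f \<in> Pkn k n"
    and "M \<noteq> {}"
    and "M \<subseteq> Ess k n f"
    and "inseparable k n M f"
    and "\<beta> \<in> Sys (Dis k n M f)"
  shows "M \<union> \<beta> \<in> Sep k n f \<and> (\<forall>\<alpha>. \<alpha> \<subset> \<beta> \<longrightarrow> M \<union> \<alpha> \<notin> Sep k n f)"
proof (intro conjI allI impI)
  have ext: "f \<in> extensional (tuples k n)"
    using assms(2) by (auto simp: Pkn_def PiE_def)
  have k: "0 < k"
    using assms(1) by simp
  have meets: "Q \<inter> \<beta> \<noteq> {}" if "Q \<in> Dis k n M f" for Q
    using assms(6) that by (auto simp: Sys_def)
  have unique: "\<exists>Q \<in> Dis k n M f. Q \<inter> \<beta> = {x}" if "x \<in> \<beta>" for x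
    using assms(6) that by (auto simp: Sys_def)
  have \<beta>: "\<beta> \<subseteq> Ess k n f"
    using unique DisD(1) by blast
  show "M \<union> \<beta> \<in> Sep k n f"
  proof -
    define J where "J = Ess k n f - (M \<union> \<beta>)"
    have J: "J \<subseteq> {1..n}"
      using Ess_subset[of k n f] by (auto simp: J_def)
    have nd: "\<not> distributes k n J M f"
    proof
      assume "distributes k n J M f"
      then obtain Q where "Q \<subseteq> J" "Q \<in> Dis k n M f"
        by (rule distributes_imp_Dis)
      with meets[of Q] show False
        unfolding J_def by blast
    qed
    obtain c where c: "c \<in> J \<rightarrow> Zk k" and M: "M \<subseteq> Ess k n (subst_consts k n f J c)"
    proof (cases "J = {}")
      \<comment> \<open>\<open>distributes\<close> demands a non-empty set, so empty
        \<open>J\<close> is a case of its own: nothing is replaced.\<close>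
      case True
      then show ?thesis
        using that[of id] assms(4) by (simp add: subst_consts_empty[OF ext])
    next
      case False
      then obtain c where "c \<in> J \<rightarrow>\<^sub>E Zk k" "M \<subseteq> Ess k n (subst_consts k n f J c)"
        using nd assms(3,4) unfolding distributes_def J_def by blast
      then show ?thesis
        using that by (auto simp: PiE_def)
    qed
    have upper: "Ess k n (subst_consts k n f J c) \<subseteq> M \<union> \<beta>"
      using Ess_subst_consts[OF J c, of f] by (auto simp: J_def)
    have "\<beta> \<subseteq> Ess k n (subst_consts k n f J c)"
    proof
      fix x
      assume "x \<in> \<beta>"
      then obtain Q where Q: "Q \<in> Dis k n M f" "Q \<inter> \<beta> = {x}"
        using unique by blast
      obtain y where y: "y \<in> Q" "y \<in> Ess k n (subst_consts k n f J c)"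
        using Dis_meets_Ess[OF k Q(1) J c M] by auto
      \<comment> \<open>\<open>Q\<close> avoids \<open>M\<close>, so \<open>upper\<close> leaves
        only \<beta> for \<open>y\<close>, and \<beta> meets \<open>Q\<close> in \<open>x\<close>
        alone; thus \<open>y\<close> is \<open>x\<close>.\<close>
      then have "y \<in> Q \<inter> \<beta>"
        using upper DisD(3)[OF Q(1)] by auto
      then show "x \<in> Ess k n (subst_consts k n f J c)"
        using y(2) Q(2) by simp
    qed
    then have "M \<union> \<beta> = Ess k n (subst_consts k n f J c)"
      using M upper by (intro equalityI) simp_all
    moreover have "M \<union> \<beta> \<noteq> {}" "M \<union> \<beta> \<subseteq> Ess k n f"
      using assms(3,4) \<beta> by simp_all
    ultimately show ?thesis
      using subst_consts_subfunction[OF ext J c] unfolding Sep_def mem_Collect_eq by metis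
  qed
  fix \<alpha>
  assume "\<alpha> \<subset> \<beta>"
  then obtain x where x: "x \<in> \<beta>" "x \<notin> \<alpha>"
    by blast
  then obtain Q where Q: "Q \<in> Dis k n M f" "Q \<inter> \<beta> = {x}"
    using unique by blast
  show "M \<union> \<alpha> \<notin> Sep k n f"
  proof
    assume "M \<union> \<alpha> \<in> Sep k n f"
    then obtain g where g: "subfunction k n g f" "M \<union> \<alpha> = Ess k n g"
      by (auto simp: Sep_def)
    obtain K c where K: "K \<subseteq> {1..n}" "c \<in> K \<rightarrow> Zk k" and "g = subst_consts k n f K c"
      using subfunction_imp_subst_consts[OF ext g(1)] by blast
    then have eq: "Ess k n (subst_consts k n f K c) = M \<union> \<alpha>"
      using g(2) by simp
    then have "Q \<inter> (M \<union> \<alpha>) \<noteq> {}"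
      using Dis_meets_Ess[OF k Q(1) K] by simp
    \<comment> \<open>\<alpha> could meet \<open>Q\<close> only in \<open>x\<close>, which it omits;
      as \<open>Q\<close> also avoids \<open>M\<close>, no essential variable of \<open>g\<close>
      lies in \<open>Q\<close>.\<close>
    moreover have "Q \<inter> \<alpha> \<subseteq> {x} - {x}"
      using Q(2) x(2) \<open>\<alpha> \<subset> \<beta>\<close> by auto
    ultimately show False
      using DisD(3)[OF Q(1)] by auto
  qed
qed

end
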